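(* Let $p\geqslant3$ and let $\pi\in S_p$ be such that both $\pi$ and its reverse $\overline{\pi}$ are non-self-overlapping. Let $m\geqslant0$ be a fixed integer. Then for any positive integer $r$, the probability that a uniform random permutation $\sigma\in S_n$ has exactly $m$ very tight occurrences of $\pi$ satisfies, as $n\to\infty$, \[ \mathbb{P}(\pi\text{ very tightly occurs in }\sigma\ m\text{ times})=\frac{1}{m!}\sum_{k=m}^{r-1}\frac{(-1)^{k-m}}{(k-m)!}\cdot\frac{\big(n-(p-1)k\big)^{\underline{k}}}{n^{\underline{(p-1)k}}}+O\left(\frac{1}{n^{(p-2)r}}\right), \] where $n^{\underline{k}}=n(n-1)\ldots(n-k+1)$ are the falling factorials. In particular, \[ \mathbb{P}(\pi\text{ very tightly occurs in }\sigma\ m\text{ times})=\frac{1}{m!}\cdot\frac{1}{n^{(p-2)m}}+O\left(\frac{1}{n^{(p-2)m+1}}\right). \]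
   Context: $S_n$ denotes the set of permutations $\sigma=\sigma_1\ldots\sigma_n$ of $\{1,\ldots,n\}$. Two sequences of distinct integers $\pi_1\ldots\pi_k$ and $\tau_1\ldots\tau_k$ are isomorphic if $\pi_i>\pi_j\Leftrightarrow\tau_i>\tau_j$ for all $i,j$. A permutation $\sigma\in S_n$, $n\geqslant1$, is self-overlapping if there is an integer $1\leqslant k<n$ such that: (1) $\{1,\ldots,k\}$ is invariant under $\sigma$; (2) $\{n-k+1,\ldots,n\}$ is invariant under $\sigma$; (3) $\sigma_1\ldots\sigma_k$ and $\sigma_{n-k+1}\ldots\sigma_n$ are isomorphic. Otherwise $\sigma$ is non-self-overlapping. The reverse of $\pi=\pi_1\pi_2\ldots\pi_p$ is $\overline{\pi}=\pi_p\pi_{p-1}\ldots\pi_1$. A very tight occurrence of $\pi\in S_p$ in $\sigma\in S_n$ is a pair of integers $0\leqslant i,h\leqslant n-p$ such that $\sigma_{i+j}=\pi_j+h$ for all $1\leqslant j\leqslant p$. The permutation $\pi$ and the integers $m,r$ are fixed as $n\to\infty$, so implied constants may depend on them. Empty sums are $0$. *)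

theory Defs
  imports
    "HOL-Probability.Probability"
    "HOL-Combinatorics.Permutations"
    "HOL-Library.Landau_Symbols"
begin

text \<open>
  The set \<open>S\<^sub>n\<close> is \<open>{\<sigma>. \<sigma> permutes {1..n}}\<close>; a permutation of \<open>{1..n}\<close> is the identity outside
  \<open>{1..n}\<close>, so none of the definitions below may look at values outside this interval.
\<close>

definition isomorphic_seqs :: "nat \<Rightarrow> (nat \<Rightarrow> nat) \<Rightarrow> (nat \<Rightarrow> nat) \<Rightarrow> bool" where
  "isomorphic_seqs k a b \<longleftrightarrow> (\<forall>i\<in>{1..k}. \<forall>j\<in>{1..k}. a i > a j \<longleftrightarrow> b i > b j)"

definition self_overlapping :: "nat \<Rightarrow> (nat \<Rightarrow> nat) \<Rightarrow> bool" where
  "self_overlapping n \<sigma> \<longleftrightarrow>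
     (\<exists>k. 1 \<le> k \<and> k < n \<and>
          \<sigma> ` {1..k} = {1..k} \<and>
          \<sigma> ` {n - k + 1..n} = {n - k + 1..n} \<and>
          isomorphic_seqs k \<sigma> (\<lambda>i. \<sigma> (n - k + i)))"

definition reverse_perm :: "nat \<Rightarrow> (nat \<Rightarrow> nat) \<Rightarrow> nat \<Rightarrow> nat" where
  "reverse_perm p \<pi> = (\<lambda>i. if i \<in> {1..p} then \<pi> (p + 1 - i) else i)"

text \<open>
  The bounds \<open>i, h \<le> n - p\<close> are written additively, so that there is no occurrence when \<open>n < p\<close>.
\<close>

definition very_tight_occurrences ::
    "nat \<Rightarrow> (nat \<Rightarrow> nat) \<Rightarrow> nat \<Rightarrow> (nat \<Rightarrow> nat) \<Rightarrow> (nat \<times> nat) set" where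
  "very_tight_occurrences p \<pi> n \<sigma> =
     {(i, h). i + p \<le> n \<and> h + p \<le> n \<and> (\<forall>j\<in>{1..p}. \<sigma> (i + j) = \<pi> j + h)}"

definition falling_factorial :: "real \<Rightarrow> nat \<Rightarrow> real" where
  "falling_factorial x k = (\<Prod>i<k. x - real i)"

definition prob_very_tight :: "nat \<Rightarrow> (nat \<Rightarrow> nat) \<Rightarrow> nat \<Rightarrow> nat \<Rightarrow> real" where
  "prob_very_tight p \<pi> m n =
     measure_pmf.prob (pmf_of_set {\<sigma>. \<sigma> permutes {1..n}})
       {\<sigma>. card (very_tight_occurrences p \<pi> n \<sigma>) = m}"

end

theory Submission
  imports Defs "HOL-Real_Asymp.Real_Asymp"
begin

text \<open>
  Let \<open>X\<close> be the number of very tight occurrences of \<open>\<pi>\<close> in a uniform \<open>\<sigma> \<in> S\<^sub>n\<close>.  An occurrence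
  occupies a block of \<open>p\<close> consecutive positions and a block of \<open>p\<close> consecutive values.  If two
  different occurrences shared \<open>k\<close> positions, with \<open>1 \<le> k < p\<close>, they would share exactly \<open>k\<close> values,
  and comparing the two copies of \<open>\<pi>\<close> on the common part would show that \<open>\<pi>\<close> is self-overlapping
  (if the later copy lies higher) or that its reverse is (if the later copy lies lower).  So under
  the hypotheses distinct occurrences are disjoint in positions and in values
  (\<open>position_overlap\<close>, \<open>value_overlap\<close>).

  This makes the binomial moments of \<open>X\<close> explicit.  A set of \<open>k\<close> occurrences amounts to \<open>k\<close> disjoint
  position blocks, \<open>k\<close> disjoint value blocks and a matching between them.  Contracting each block of
  length \<open>p\<close> to a point shows that the blocks on each side can be chosen in \<open>(n - (p-1)k) choose k\<close>
  ways, the matching in \<open>k!\<close> ways, and the remaining \<open>n - pk\<close> points of \<open>\<sigma>\<close> are then free.  Dividing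
  by \<open>n!\<close> yields the factorial moment
  \[ k!\,\mathbb{E}\binom{X}{k} = \frac{(n-(p-1)k)^{\underline{k}}}{n^{\underline{(p-1)k}}}
     = n^{-(p-2)k}\,\bigl(1 + O(1/n)\bigr) \]
  (\<open>binomial_moment_eq\<close>, \<open>factorial_moment_asymp\<close>).

  The probability of \<open>X = m\<close> is the alternating sum of \<open>(k choose m)\<close> times the \<open>k\<close>-th binomial
  moment over \<open>k \<ge> m\<close>, and by Bonferroni's inequalities the error made by truncating it before
  \<open>k = r\<close>, for any \<open>r \<ge> m\<close>, is at most the first omitted term, hence \<open>O(n\<^bsup>-(p-2)r\<^esup>)\<close>.
\<close>

section \<open>Distinct occurrences are disjoint\<close>

text \<open>
  Suppose the second copy starts \<open>d < p\<close> positions after the first.  The \<open>k = p - d\<close> common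
  positions carry exactly the values common to the two value blocks, because \<open>\<sigma>\<close> is injective, so
  the value blocks are also shifted by \<open>d\<close>, up or down.  The common values then form the initial
  segment of one value block and the final segment of the other.  Read off in \<open>\<pi>\<close>, this says that
  \<open>{1..k}\<close> and \<open>{d+1..p}\<close> are both invariant (upward shift) or are exchanged (downward shift), and
  the order pattern of \<open>\<pi>\<close> is the same on both.  Reversal turns the exchange into invariance.
\<close>
lemma position_overlap:
  assumes \<pi>: "\<pi> permutes {1..p}"
    and nso: "\<not> self_overlapping p \<pi>" "\<not> self_overlapping p (reverse_perm p \<pi>)"
    and \<sigma>: "inj \<sigma>"
    and occ: "\<And>j. j \<in> {1..p} \<Longrightarrow> \<sigma> (i + j) = \<pi> j + h"
    and occ': "\<And>j. j \<in> {1..p} \<Longrightarrow> \<sigma> (i' + j) = \<pi> j + h'"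
    and less: "i < i'"
  shows "i + p \<le> i'"
proof (rule ccontr)
  assume "\<not> i + p \<le> i'"
  define d where "d = i' - i"
  define k where "k = p - d"
  have d: "1 \<le> d" "d < p" "i' = i + d" and k: "1 \<le> k" "k < p" "p = d + k" "p - k = d"
    using less \<open>\<not> i + p \<le> i'\<close> by (auto simp: d_def k_def)
  have shift: "(\<lambda>x. x + c) ` {a..b} = {a + c..b + c}" for a b c :: nat
    by simp
  have img: "\<pi> ` {1..p} = {1..p}"
    using \<pi> by (rule permutes_image)
  have window: "\<sigma> ` {i + a..i + b} = (\<lambda>x. x + h) ` \<pi> ` {a..b}" if "1 \<le> a" "b \<le> p" for a b
  proof -
    have "\<sigma> ` {i + a..i + b} = \<sigma> ` (\<lambda>j. i + j) ` {a..b}"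
      unfolding image_add_atLeastAtMost by (simp only: add.commute)
    also have "\<dots> = (\<lambda>x. x + h) ` \<pi> ` {a..b}"
      unfolding image_image using that by (intro image_cong refl occ) auto
    finally show ?thesis .
  qed
  have window': "\<sigma> ` {i' + a..i' + b} = (\<lambda>x. x + h') ` \<pi> ` {a..b}" if "1 \<le> a" "b \<le> p" for a b
  proof -
    have "\<sigma> ` {i' + a..i' + b} = \<sigma> ` (\<lambda>j. i' + j) ` {a..b}"
      unfolding image_add_atLeastAtMost by (simp only: add.commute)
    also have "\<dots> = (\<lambda>x. x + h') ` \<pi> ` {a..b}"
      unfolding image_image using that by (intro image_cong refl occ') auto
    finally show ?thesis .
  qed
  define C where "C = \<sigma> ` {i' + 1..i + p}"
  have "{i' + 1..i + p} = {i + 1..i + p} \<inter> {i' + 1..i' + p}"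
    using less by auto
  then have "C = \<sigma> ` {i + 1..i + p} \<inter> \<sigma> ` {i' + 1..i' + p}"
    unfolding C_def by (metis \<sigma> image_Int)
  also have "\<dots> = {1 + h..p + h} \<inter> {1 + h'..p + h'}"
    using window[of 1 p] window'[of 1 p] by (simp only: img shift order.refl)
  finally have C: "C = {1 + h..p + h} \<inter> {1 + h'..p + h'}" .
  have cardC: "card C = k"
    unfolding C_def using \<sigma> d k by (subst card_image) (auto intro: inj_on_subset)
  have C1: "C = (\<lambda>x. x + h') ` \<pi> ` {1..k}"
    unfolding C_def using window'[of 1 k] d k by (simp add: add.commute add.left_commute)
  have C2: "C = (\<lambda>x. x + h) ` \<pi> ` {d + 1..p}"
    unfolding C_def using window[of "d + 1" p] d k by (simp add: add.commute add.left_commute)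
  have cancel: "X = Y" if "(\<lambda>x. x + c) ` X = (\<lambda>x. x + c) ` Y" for c :: nat and X Y
    using that by (simp add: inj_image_eq_iff)
  have step: "\<pi> j + h' = \<pi> (d + j) + h" if "j \<in> {1..k}" for j
    using that occ[of "d + j"] occ'[of j] d k by (simp add: add.assoc)
  show False
  proof (cases "h \<le> h'")
    case True
    then have C3: "C = {1 + h'..p + h}"
      using C by auto
    then have "p + h - h' = k"
      using cardC by simp
    then have h': "h' = h + d"
      using k d True by linarith
    have e: "p + h = k + h'" "1 + h' = d + 1 + h"
      using h' k by linarith+
    have "\<pi> ` {1..k} = {1..k}"
      by (rule cancel[of h']) (simp only: C1[symmetric] C3 shift e)
    moreover have "\<pi> ` {d + 1..p} = {d + 1..p}"
      by (rule cancel[of h]) (simp only: C2[symmetric] C3 shift e)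
    moreover have "isomorphic_seqs k \<pi> (\<lambda>j. \<pi> (d + j))"
      unfolding isomorphic_seqs_def using step h' by (metis add_less_cancel_right)
    ultimately have "self_overlapping p \<pi>"
      unfolding self_overlapping_def using k(1,2)
      by (intro exI[of _ k] conjI) (simp_all only: k(4))
    with nso(1) show False ..
  next
    case False
    then have C3: "C = {1 + h..p + h'}"
      using C by auto
    then have "p + h' - h = k"
      using cardC by simp
    then have h: "h = h' + d"
      using k d False by linarith
    have e: "p + h' = k + h" "1 + h = d + 1 + h'"
      using h k by linarith+
    have p1: "\<pi> ` {1..k} = {d + 1..p}"
      by (rule cancel[of h']) (simp only: C1[symmetric] C3 shift e)
    have p2: "\<pi> ` {d + 1..p} = {1..k}"
      by (rule cancel[of h]) (simp only: C2[symmetric] C3 shift e)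
    have mirror: "reverse_perm p \<pi> ` {a..b} = \<pi> ` {p + 1 - b..p + 1 - a}"
      if "1 \<le> a" "a \<le> b" "b \<le> p" for a b
    proof -
      have "{p + 1 - b..p + 1 - a} = (\<lambda>j. p + 1 - j) ` {a..b}"
      proof (intro equalityI subsetI)
        fix x assume "x \<in> {p + 1 - b..p + 1 - a}"
        then have "x = p + 1 - (p + 1 - x)" "p + 1 - x \<in> {a..b}"
          using that by auto
        then show "x \<in> (\<lambda>j. p + 1 - j) ` {a..b}"
          by blast
      qed (use that in auto)
      then show ?thesis
        using that by (auto simp: reverse_perm_def image_image intro!: image_cong)
    qed
    have "reverse_perm p \<pi> ` {1..k} = {1..k}"
      using mirror[of 1 k] p2 k by simp
    moreover have "reverse_perm p \<pi> ` {d + 1..p} = {d + 1..p}"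
      using mirror[of "d + 1" p] p1 k d by simp
    moreover have "isomorphic_seqs k (reverse_perm p \<pi>) (\<lambda>j. reverse_perm p \<pi> (d + j))"
    proof -
      have r1: "reverse_perm p \<pi> a = \<pi> (d + (k + 1 - a))"
        and r2: "reverse_perm p \<pi> (d + a) = \<pi> (k + 1 - a)" if "a \<in> {1..k}" for a
        using that k by (auto simp: reverse_perm_def)
      have "reverse_perm p \<pi> a + h = reverse_perm p \<pi> (d + a) + h'" if "a \<in> {1..k}" for a
      proof -
        have "k + 1 - a \<in> {1..k}"
          using that by auto
        from step[OF this] show ?thesis
          by (simp only: r1[OF that] r2[OF that])
      qed
      then show ?thesis
        unfolding isomorphic_seqs_def by (metis add_less_cancel_right)
    qed
    ultimately have "self_overlapping p (reverse_perm p \<pi>)"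
      unfolding self_overlapping_def using k(1,2)
      by (intro exI[of _ k] conjI) (simp_all only: k(4))
    with nso(2) show False ..
  qed
qed

text \<open>
  A common value has a single preimage, which lies in both position blocks; so an overlap in values
  forces one in positions.
\<close>
lemma value_overlap:
  assumes \<pi>: "\<pi> permutes {1..p}"
    and nso: "\<not> self_overlapping p \<pi>" "\<not> self_overlapping p (reverse_perm p \<pi>)"
    and \<sigma>: "inj \<sigma>"
    and occ: "\<And>j. j \<in> {1..p} \<Longrightarrow> \<sigma> (i + j) = \<pi> j + h"
    and occ': "\<And>j. j \<in> {1..p} \<Longrightarrow> \<sigma> (i' + j) = \<pi> j + h'"
    and less: "h < h'"
  shows "h + p \<le> h'"
proof (rule ccontr)
  assume not: "\<not> h + p \<le> h'"
  then have "p \<ge> 1"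
    using less by auto
  have img: "\<pi> ` {1..p} = {1..p}"
    using \<pi> by (rule permutes_image)
  \<comment> \<open>the smallest value of the upper block, \<open>h' + 1\<close>, also lies in the lower one\<close>
  have "h' + 1 - h \<in> \<pi> ` {1..p}" "1 \<in> \<pi> ` {1..p}"
    unfolding img using less not \<open>p \<ge> 1\<close> by auto
  then obtain j j' where j: "j \<in> {1..p}" "\<pi> j = h' + 1 - h" and j': "j' \<in> {1..p}" "\<pi> j' = 1"
    by (metis imageE)
  have "\<sigma> (i + j) = \<sigma> (i' + j')"
    using occ[OF j(1)] occ'[OF j'(1)] j j' less by simp
  then have eq: "i + j = i' + j'"
    using \<sigma> by (simp add: inj_eq)
  consider "i < i'" | "i' < i" | "i = i'"
    by linarith
  then show False
  proof cases
    case 1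
    then show False
      using position_overlap[OF \<pi> nso \<sigma> occ occ'] eq j j' by auto
  next
    case 2
    then show False
      using position_overlap[OF \<pi> nso \<sigma> occ' occ] eq j j' by auto
  next
    case 3
    then show False
      using occ[OF j(1)] occ'[OF j(1)] less by simp
  qed
qed

section \<open>Counting sets of disjoint occurrences\<close>

text \<open>
  A block \<open>{i+1..i+p}\<close> is represented by its offset \<open>i\<close>, so these are the \<open>k\<close>-sets of pairwise
  disjoint blocks of length \<open>p\<close> in \<open>{1..n}\<close>.
\<close>
definition spaced_sets :: "nat \<Rightarrow> nat \<Rightarrow> nat \<Rightarrow> nat set set" where
  "spaced_sets p n k =
     {P. card P = k \<and> (\<forall>i\<in>P. i + p \<le> n) \<and> (\<forall>i\<in>P. \<forall>j\<in>P. i < j \<longrightarrow> i + p \<le> j)}"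

lemma spaced_set_finite: "P \<in> spaced_sets p n k \<Longrightarrow> finite P"
  by (rule finite_subset[of _ "{..n}"]) (auto simp: spaced_sets_def)

lemma finite_spaced_sets: "finite (spaced_sets p n k)"
  by (rule finite_subset[of _ "Pow {..n}"]) (auto simp: spaced_sets_def)

lemma spaced_sets_0: "spaced_sets p n 0 = {{}}"
proof (intro equalityI subsetI)
  fix P assume P: "P \<in> spaced_sets p n 0"
  then have "card P = 0"
    by (simp add: spaced_sets_def)
  with spaced_set_finite[OF P] show "P \<in> {{}}"
    by simp
qed (simp add: spaced_sets_def)

text \<open>
  Either the last block \<open>{n-p+1..n}\<close> is absent and the point \<open>n\<close> is uncovered, or it is present and
  the other blocks lie in \<open>{1..n-p}\<close>.  On cardinalities this is Pascal's rule.
\<close>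
lemma spaced_sets_Suc:
  assumes "1 \<le> p" "p \<le> n"
  shows "spaced_sets p n (Suc k) =
           spaced_sets p (n - 1) (Suc k) \<union> insert (n - p) ` spaced_sets p (n - p) k"
proof (intro equalityI subsetI)
  fix P assume P: "P \<in> spaced_sets p n (Suc k)"
  show "P \<in> spaced_sets p (n - 1) (Suc k) \<union> insert (n - p) ` spaced_sets p (n - p) k"
  proof (cases "n - p \<in> P")
    case True
    have "j \<le> n - p" if "j \<in> P" for j
      using P that by (auto simp: spaced_sets_def dest!: bspec[of P _ j])
    then have "P - {n - p} \<in> spaced_sets p (n - p) k"
      using P True spaced_set_finite[OF P]
      by (auto simp: spaced_sets_def le_neq_implies_less)
    then show ?thesis
      using True by (metis UnI2 image_eqI insert_Diff)
  next
    case False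
    have "j + p \<le> n - 1" if "j \<in> P" for j
    proof -
      have "j + p \<le> n" "j \<noteq> n - p"
        using P that False by (auto simp: spaced_sets_def)
      then show ?thesis by linarith
    qed
    then show ?thesis
      using P by (auto simp: spaced_sets_def)
  qed
next
  fix P assume "P \<in> spaced_sets p (n - 1) (Suc k) \<union> insert (n - p) ` spaced_sets p (n - p) k"
  then consider "P \<in> spaced_sets p (n - 1) (Suc k)"
    | Q where "P = insert (n - p) Q" "Q \<in> spaced_sets p (n - p) k"
    by blast
  then show "P \<in> spaced_sets p n (Suc k)"
  proof cases
    case 1
    then show ?thesis
      by (force simp: spaced_sets_def)
  next
    case 2
    have Q: "j + p \<le> n - p" if "j \<in> Q" for j
      using 2(2) that by (auto simp: spaced_sets_def)
    then have "n - p \<notin> Q"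
      using assms by force
    then have "card P = Suc k"
      using 2 spaced_set_finite[OF 2(2)] by (simp add: spaced_sets_def)
    moreover have "\<forall>i\<in>P. i + p \<le> n"
      using Q 2(1) assms by force
    moreover have "\<forall>i\<in>P. \<forall>j\<in>P. i < j \<longrightarrow> i + p \<le> j"
      using 2 Q by (fastforce simp: spaced_sets_def)
    ultimately show ?thesis
      by (simp add: spaced_sets_def)
  qed
qed

lemma card_spaced_sets:
  assumes "1 \<le> p"
  shows "card (spaced_sets p n k) = (n - (p - 1) * k) choose k"
proof (induction n arbitrary: k rule: less_induct)
  case (less n)
  show ?case
  proof (cases k)
    case 0
    then show ?thesis
      by (simp add: spaced_sets_0)
  next
    case (Suc l)
    show ?thesis
    proof (cases "p \<le> n")
      case False
      have "P = {}" if "P \<in> spaced_sets p n k" for P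
        using that False by (auto simp: spaced_sets_def)
      then have "spaced_sets p n k = {}"
        using Suc by (force simp: spaced_sets_def)
      moreover have "n - (p - 1) * k < k"
      proof -
        have "p - 1 \<le> (p - 1) * k"
          using Suc by simp
        then show ?thesis
          using Suc False by linarith
      qed
      ultimately show ?thesis
        by (simp add: binomial_eq_0)
    next
      case True
      have notin: "n - p \<notin> Q" if "Q \<in> spaced_sets p (n - p) l" for Q
        using that assms by (force simp: spaced_sets_def)
      have inj: "inj_on (insert (n - p)) (spaced_sets p (n - p) l)"
        by (rule inj_onI) (metis notin insert_ident)
      have disj: "spaced_sets p (n - 1) (Suc l) \<inter> insert (n - p) ` spaced_sets p (n - p) l = {}"
      proof -
        have "n - p \<notin> P" if "P \<in> spaced_sets p (n - 1) (Suc l)" for P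
          using that assms True by (auto simp: spaced_sets_def dest!: bspec[of P _ "n - p"])
        then show ?thesis
          by blast
      qed
      have "card (spaced_sets p n k) =
              card (spaced_sets p (n - 1) (Suc l)) + card (spaced_sets p (n - p) l)"
        unfolding Suc spaced_sets_Suc[OF assms True]
        using disj by (subst card_Un_disjoint) (simp_all add: finite_spaced_sets card_image[OF inj])
      also have "\<dots> = ((n - 1 - (p - 1) * Suc l) choose Suc l) + ((n - p - (p - 1) * l) choose l)"
        using less.IH[of "n - 1"] less.IH[of "n - p"] assms True by simp
      also have "\<dots> = (n - (p - 1) * Suc l) choose Suc l"
      proof (cases "(p - 1) * Suc l < n")
        case lt: True
        \<comment> \<open>both smaller families are counted with the same upper index, so Pascal's rule applies\<close>
        define N where "N = n - 1 - (p - 1) * Suc l"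
        have N: "n - (p - 1) * Suc l = Suc N" "n - p - (p - 1) * l = N"
          using lt assms True by (auto simp: N_def)
        then show ?thesis
          by (simp only: N N_def[symmetric] binomial_Suc_Suc add.commute)
      next
        (* truncated subtraction makes every upper index 0, so all three coefficients must vanish *)
        case ge: False
        have "n - p - (p - 1) * l = 0" "n - (p - 1) * Suc l = 0"
          using ge assms by auto
        moreover have "l > 0"
          using ge assms True by (cases l) auto
        ultimately show ?thesis
          by (simp add: binomial_eq_0)
      qed
      finally show ?thesis
        by (simp only: Suc)
    qed
  qed
qed

text \<open>
  A relation that is injective in both coordinates is a partial matching.  Both counts below, of
  permutations extending a matching and of perfect matchings, are obtained by viewing it as the
  graph of a bijection.
\<close>
lemma matching_bijection:
  assumes "inj_on fst R" "inj_on snd R"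
  obtains g where "bij_betw g (fst ` R) (snd ` R)" "R = (\<lambda>x. (x, g x)) ` fst ` R"
proof -
  define g where "g = snd \<circ> the_inv_into R fst"
  have g: "g (fst z) = snd z" if "z \<in> R" for z
    using that assms(1) by (simp add: g_def the_inv_into_f_f)
  have "bij_betw (the_inv_into R fst) (fst ` R) R"
    using assms(1) by (simp add: bij_betw_the_inv_into inj_on_imp_bij_betw)
  moreover have "bij_betw snd R (snd ` R)"
    using assms(2) by (rule inj_on_imp_bij_betw)
  ultimately have "bij_betw g (fst ` R) (snd ` R)"
    unfolding g_def by (rule bij_betw_trans)
  moreover have "R = (\<lambda>x. (x, g x)) ` fst ` R"
    using g by (force simp: image_image)
  ultimately show ?thesis
    by (rule that)
qed

text \<open>
  Once one permutation \<open>\<tau>\<close> of \<open>U\<close> extends the matching, all the others are \<open>\<tau> \<circ> \<rho>\<close> for a unique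
  permutation \<open>\<rho>\<close> of the points of \<open>U\<close> that the matching leaves free.
\<close>
lemma card_permutes_extending:
  assumes "finite U" "R \<subseteq> U \<times> U" "inj_on fst R" "inj_on snd R"
  shows "card {\<sigma>. \<sigma> permutes U \<and> (\<forall>(x, y)\<in>R. \<sigma> x = y)} = fact (card U - card R)"
proof -
  define A where "A = fst ` R"
  define B where "B = snd ` R"
  have sub: "A \<subseteq> U" "B \<subseteq> U"
    using assms by (auto simp: A_def B_def)
  then have fin: "finite A" "finite B"
    using \<open>finite U\<close> by (auto intro: finite_subset)
  have card: "card A = card R" "card B = card R"
    using assms by (simp_all add: A_def B_def card_image)
  obtain g where g: "bij_betw g A B" "R = (\<lambda>x. (x, g x)) ` A"
    using matching_bijection[OF assms(3,4)] unfolding A_def B_def by blast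
  have "card (U - A) = card (U - B)"
    using sub fin card by (simp add: card_Diff_subset)
  then obtain f where f: "bij_betw f (U - A) (U - B)"
    using finite_same_card_bij[of "U - A" "U - B"] \<open>finite U\<close> by auto
  define \<tau> where "\<tau> x = (if x \<in> A then g x else if x \<in> U then f x else x)" for x
  have "bij_betw \<tau> A B"
    using g(1) by (rule bij_betw_cong[THEN iffD1, rotated]) (simp add: \<tau>_def)
  moreover have "bij_betw \<tau> (U - A) (U - B)"
    using f by (rule bij_betw_cong[THEN iffD1, rotated]) (simp add: \<tau>_def)
  ultimately have "bij_betw \<tau> (A \<union> (U - A)) (B \<union> (U - B))"
    by (rule bij_betw_combine) auto
  moreover have "A \<union> (U - A) = U" "B \<union> (U - B) = U"
    using sub by auto
  ultimately have \<tau>: "\<tau> permutes U"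
    using sub by (intro bij_imp_permutes) (auto simp: \<tau>_def)
  have R: "(\<forall>(x, y)\<in>R. \<sigma> x = y) \<longleftrightarrow> (\<forall>x\<in>A. \<sigma> x = \<tau> x)" for \<sigma>
    unfolding g(2) by (auto simp: \<tau>_def)
  have "{\<sigma>. \<sigma> permutes U \<and> (\<forall>x\<in>A. \<sigma> x = \<tau> x)} = (\<lambda>\<rho>. \<tau> \<circ> \<rho>) ` {\<rho>. \<rho> permutes (U - A)}"
  proof (intro equalityI subsetI)
    fix \<sigma> assume \<sigma>: "\<sigma> \<in> {\<sigma>. \<sigma> permutes U \<and> (\<forall>x\<in>A. \<sigma> x = \<tau> x)}"
    define \<rho> where "\<rho> = inv \<tau> \<circ> \<sigma>"
    have "\<rho> permutes U"
      using \<sigma> \<tau> by (simp add: \<rho>_def permutes_compose permutes_inv)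
    moreover have "\<rho> x = x" if "x \<in> A" for x
      using \<sigma> \<tau> that by (simp add: \<rho>_def permutes_inverses)
    ultimately have "\<rho> permutes (U - A)"
      by (rule permutes_superset) auto
    moreover have "\<sigma> = \<tau> \<circ> \<rho>"
      using \<tau> by (simp add: \<rho>_def fun_eq_iff permutes_inverses)
    ultimately show "\<sigma> \<in> (\<lambda>\<rho>. \<tau> \<circ> \<rho>) ` {\<rho>. \<rho> permutes (U - A)}"
      by blast
  next
    fix \<sigma> assume "\<sigma> \<in> (\<lambda>\<rho>. \<tau> \<circ> \<rho>) ` {\<rho>. \<rho> permutes (U - A)}"
    then obtain \<rho> where \<rho>: "\<rho> permutes (U - A)" "\<sigma> = \<tau> \<circ> \<rho>"
      by blast
    then have "\<rho> permutes U"
      by (meson Diff_subset permutes_subset)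
    then have "\<sigma> permutes U"
      using \<rho>(2) \<tau> by (simp add: permutes_compose)
    moreover have "\<rho> x = x" if "x \<in> A" for x
      using \<rho>(1) that by (simp add: permutes_not_in)
    ultimately show "\<sigma> \<in> {\<sigma>. \<sigma> permutes U \<and> (\<forall>x\<in>A. \<sigma> x = \<tau> x)}"
      using \<rho>(2) by auto
  qed
  moreover have "inj_on (\<lambda>\<rho>. \<tau> \<circ> \<rho>) {\<rho>. \<rho> permutes (U - A)}"
  proof (intro inj_onI ext)
    fix \<rho> \<rho>' x assume "\<tau> \<circ> \<rho> = \<tau> \<circ> \<rho>'"
    then have "\<tau> (\<rho> x) = \<tau> (\<rho>' x)"
      by (metis comp_apply)
    with permutes_inj[OF \<tau>] show "\<rho> x = \<rho>' x"
      by (rule injD)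
  qed
  ultimately have "card {\<sigma>. \<sigma> permutes U \<and> (\<forall>x\<in>A. \<sigma> x = \<tau> x)} = card {\<rho>. \<rho> permutes (U - A)}"
    by (simp add: card_image)
  also have "\<dots> = fact (card U - card R)"
    using sub fin card \<open>finite U\<close> by (simp add: card_permutations[OF refl] card_Diff_subset)
  finally show ?thesis
    unfolding R .
qed

lemma card_perfect_matchings:
  assumes "finite P" "finite H" "card P = k" "card H = k"
  shows "card {S. inj_on fst S \<and> inj_on snd S \<and> fst ` S = P \<and> snd ` S = H} = fact k"
proof -
  obtain \<tau> where \<tau>: "bij_betw \<tau> P H"
    using finite_same_card_bij assms by metis
  define G where "G \<rho> = (\<lambda>x. (x, \<tau> (\<rho> x))) ` P" for \<rho>
  have "{S. inj_on fst S \<and> inj_on snd S \<and> fst ` S = P \<and> snd ` S = H} = G ` {\<rho>. \<rho> permutes P}"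
  proof (intro equalityI subsetI)
    fix S assume S: "S \<in> {S. inj_on fst S \<and> inj_on snd S \<and> fst ` S = P \<and> snd ` S = H}"
    then obtain g where g: "bij_betw g P H" "S = (\<lambda>x. (x, g x)) ` P"
      using matching_bijection[of S] by blast
    define \<rho> where "\<rho> x = (if x \<in> P then inv_into P \<tau> (g x) else x)" for x
    have "bij_betw (inv_into P \<tau> \<circ> g) P P"
      using g(1) bij_betw_inv_into[OF \<tau>] by (rule bij_betw_trans)
    then have "bij_betw \<rho> P P"
      by (rule bij_betw_cong[THEN iffD1, rotated]) (simp add: \<rho>_def)
    then have "\<rho> permutes P"
      by (rule bij_imp_permutes) (simp add: \<rho>_def)
    moreover have "\<tau> (\<rho> x) = g x" if "x \<in> P" for x
    proof -
      have "g x \<in> \<tau> ` P"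
        using that g(1) \<tau> by (auto simp: bij_betw_def)
      then show ?thesis
        using that by (simp add: \<rho>_def f_inv_into_f)
    qed
    ultimately show "S \<in> G ` {\<rho>. \<rho> permutes P}"
      unfolding g(2) G_def by (intro image_eqI[of _ _ \<rho>]) auto
  next
    fix S assume "S \<in> G ` {\<rho>. \<rho> permutes P}"
    then obtain \<rho> where \<rho>: "\<rho> permutes P" "S = G \<rho>"
      by blast
    have b: "bij_betw (\<tau> \<circ> \<rho>) P H"
      using permutes_imp_bij[OF \<rho>(1)] \<tau> by (rule bij_betw_trans)
    then have "inj_on (\<lambda>x. \<tau> (\<rho> x)) P" "(\<lambda>x. \<tau> (\<rho> x)) ` P = H"
      by (auto simp: bij_betw_def o_def)
    then show "S \<in> {S. inj_on fst S \<and> inj_on snd S \<and> fst ` S = P \<and> snd ` S = H}"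
      unfolding \<rho>(2) G_def by (auto simp: inj_on_def image_image)
  qed
  moreover have "inj_on G {\<rho>. \<rho> permutes P}"
  proof (intro inj_onI ext)
    fix \<rho> \<rho>' x
    assume \<rho>: "\<rho> \<in> {\<rho>. \<rho> permutes P}" "\<rho>' \<in> {\<rho>. \<rho> permutes P}" and eq: "G \<rho> = G \<rho>'"
    from \<rho> have perm: "\<rho> permutes P" "\<rho>' permutes P"
      by simp_all
    show "\<rho> x = \<rho>' x"
    proof (cases "x \<in> P")
      case True
      then have "(x, \<tau> (\<rho> x)) \<in> G \<rho>"
        unfolding G_def by (rule imageI)
      then have "(x, \<tau> (\<rho> x)) \<in> G \<rho>'"
        by (simp only: eq)
      then have "\<tau> (\<rho> x) = \<tau> (\<rho>' x)"
        by (auto simp: G_def)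
      moreover have "\<rho> x \<in> P" "\<rho>' x \<in> P"
        using True permutes_in_image[OF perm(1)] permutes_in_image[OF perm(2)] by simp_all
      ultimately show ?thesis
        using inj_onD[OF bij_betw_imp_inj_on[OF \<tau>]] by blast
    next
      case False
      then show ?thesis
        using permutes_not_in[OF perm(1)] permutes_not_in[OF perm(2)] by simp
    qed
  qed
  ultimately show ?thesis
    using assms by (simp add: card_image card_permutations)
qed

text \<open>
  A placement is a set of offset pairs \<open>(i, h)\<close> whose \<open>k\<close> position blocks are disjoint and whose \<open>k\<close>
  value blocks are disjoint: the possible sets of \<open>k\<close> occurrences.
\<close>
definition placements :: "nat \<Rightarrow> nat \<Rightarrow> nat \<Rightarrow> (nat \<times> nat) set set" where
  "placements p n k =
     {S. inj_on fst S \<and> inj_on snd S \<and> fst ` S \<in> spaced_sets p n k \<and> snd ` S \<in> spaced_sets p n k}"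

lemma card_placements:
  assumes "1 \<le> p"
  shows "card (placements p n k) = fact k * ((n - (p - 1) * k) choose k)\<^sup>2"
proof -
  define M where "M = (\<lambda>(P, H). {S :: (nat \<times> nat) set.
    inj_on fst S \<and> inj_on snd S \<and> fst ` S = P \<and> snd ` S = H})"
  define I where "I = spaced_sets p n k \<times> spaced_sets p n k"
  have M: "card (M z) = fact k" if zI: "z \<in> I" for z
  proof -
    obtain P H where z: "z = (P, H)" and PH: "P \<in> spaced_sets p n k" "H \<in> spaced_sets p n k"
      using zI unfolding I_def by (rule SigmaE)
    then have "card P = k" "card H = k"
      by (simp_all add: spaced_sets_def)
    with PH[THEN spaced_set_finite] show ?thesis
      unfolding z M_def prod.case by (rule card_perfect_matchings)
  qed
  have "finite (M z)" if "z \<in> I" for z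
    using M[OF that] by (metis card.infinite fact_nonzero)
  then have "card (Sigma I M) = (\<Sum>z\<in>I. card (M z))"
    by (intro card_SigmaI) (auto simp: I_def finite_spaced_sets)
  also have "\<dots> = fact k * ((n - (p - 1) * k) choose k)\<^sup>2"
    using M by (simp add: I_def card_cartesian_product card_spaced_sets[OF assms] power2_eq_square)
  finally have "card (Sigma I M) = fact k * ((n - (p - 1) * k) choose k)\<^sup>2" .
  moreover have "placements p n k = snd ` Sigma I M"
    unfolding placements_def M_def I_def by (force simp: image_iff)
  moreover have "inj_on snd (Sigma I M)"
    by (auto simp: inj_on_def M_def)
  ultimately show ?thesis
    by (simp add: card_image)
qed

lemma finite_placements: "finite (placements p n k)"
proof (rule finite_subset)
  show "placements p n k \<subseteq> Pow ({..n} \<times> {..n})"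
  proof (intro subsetI PowI)
    fix S z assume S: "S \<in> placements p n k" and z: "z \<in> S"
    then have "fst z + p \<le> n" "snd z + p \<le> n"
      by (auto simp: placements_def spaced_sets_def)
    then show "z \<in> {..n} \<times> {..n}"
      by (cases z) simp
  qed
qed simp

lemma card_placement: "S \<in> placements p n k \<Longrightarrow> card S = k"
  by (auto simp: placements_def spaced_sets_def card_image)

text \<open>
  Disjointness of the blocks means that the \<open>pk\<close> conditions \<open>\<sigma> (i + j) = \<pi> j + h\<close> are consistent
  and form a matching of size \<open>pk\<close>.
\<close>
lemma card_permutes_containing_placement:
  assumes \<pi>: "\<pi> permutes {1..p}" and S: "S \<in> placements p n k"
  shows "card {\<sigma>. \<sigma> permutes {1..n} \<and> S \<subseteq> very_tight_occurrences p \<pi> n \<sigma>} = fact (n - p * k)"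
proof -
  define E where "E = (\<lambda>((i, h), j). (i + j, \<pi> j + h))"
  define R where "R = E ` (S \<times> {1..p})"
  have bound: "i + p \<le> n" "h + p \<le> n" if "(i, h) \<in> S" for i h
    using S that by (force simp: placements_def spaced_sets_def)+
  have \<pi>_in: "\<pi> j \<in> {1..p}" if "j \<in> {1..p}" for j
    using \<pi> that by (simp add: permutes_in_image del: atLeastAtMost_iff)
  have proj: "inj_on fst S" "inj_on snd S"
    using S by (simp_all add: placements_def)
  have far: "\<forall>a\<in>fst ` S. \<forall>b\<in>fst ` S. a < b \<longrightarrow> a + p \<le> b"
      "\<forall>a\<in>snd ` S. \<forall>b\<in>snd ` S. a < b \<longrightarrow> a + p \<le> b"
    using S by (simp_all add: placements_def spaced_sets_def)
  have gap: "i + p \<le> i'" if "(i, h) \<in> S" "(i', h') \<in> S" "i < i'" for i h i' h'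
    using far(1)[rule_format, OF imageI[OF that(1)] imageI[OF that(2)]] that(3) by simp
  have gap': "h + p \<le> h'" if "(i, h) \<in> S" "(i', h') \<in> S" "h < h'" for i h i' h'
    using far(2)[rule_format, OF imageI[OF that(1)] imageI[OF that(2)]] that(3) by simp
  have uniq: "h = h'" if "(i, h) \<in> S" "(i, h') \<in> S" for i h h'
    using inj_onD[OF proj(1) _ that] by simp
  have uniq': "i = i'" if "(i, h) \<in> S" "(i', h) \<in> S" for i h i'
    using inj_onD[OF proj(2) _ that] by simp
  have inj1: "inj_on (fst \<circ> E) (S \<times> {1..p})"
  proof (rule inj_onI)
    fix z z' assume z: "z \<in> S \<times> {1..p}" "z' \<in> S \<times> {1..p}" and eq: "(fst \<circ> E) z = (fst \<circ> E) z'"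
    obtain i h j where z1: "z = ((i, h), j)"
      by (metis surj_pair)
    obtain i' h' j' where z2: "z' = ((i', h'), j')"
      by (metis surj_pair)
    have e: "i + j = i' + j'"
      using eq by (simp add: z1 z2 E_def)
    have "i = i'"
      using gap[of i h i' h'] gap[of i' h' i h] z e unfolding z1 z2 by (cases i i' rule: linorder_cases) auto
    then show "z = z'"
      using uniq z e unfolding z1 z2 by auto
  qed
  have inj2: "inj_on (snd \<circ> E) (S \<times> {1..p})"
  proof (rule inj_onI)
    fix z z' assume z: "z \<in> S \<times> {1..p}" "z' \<in> S \<times> {1..p}" and eq: "(snd \<circ> E) z = (snd \<circ> E) z'"
    obtain i h j where z1: "z = ((i, h), j)"
      by (metis surj_pair)
    obtain i' h' j' where z2: "z' = ((i', h'), j')"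
      by (metis surj_pair)
    have e: "\<pi> j + h = \<pi> j' + h'"
      using eq by (simp add: z1 z2 E_def)
    have r: "\<pi> j \<in> {1..p}" "\<pi> j' \<in> {1..p}"
      using \<pi>_in z unfolding z1 z2 by blast+
    have h: "h = h'"
      using gap'[of i h i' h'] gap'[of i' h' i h] z e r unfolding z1 z2
      by (cases h h' rule: linorder_cases) auto
    then have "\<pi> j = \<pi> j'"
      using e by simp
    then have "j = j'"
      using permutes_inj[OF \<pi>] by (simp add: inj_eq)
    then show "z = z'"
      using uniq' z h unfolding z1 z2 by auto
  qed
  have "inj_on fst R" "inj_on snd R" "inj_on E (S \<times> {1..p})"
    unfolding R_def using inj1 inj2 by (auto intro: inj_on_imageI inj_on_imageI2)
  moreover have "R \<subseteq> {1..n} \<times> {1..n}"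
  proof
    fix z assume "z \<in> R"
    then obtain i h j where z: "z = (i + j, \<pi> j + h)" "(i, h) \<in> S" "j \<in> {1..p}"
      by (auto simp: R_def E_def)
    then show "z \<in> {1..n} \<times> {1..n}"
      using bound[OF z(2)] \<pi>_in[OF z(3)] by auto
  qed
  moreover have "card R = p * k"
    unfolding R_def using \<open>inj_on E _\<close> card_placement[OF S]
    by (simp add: card_image card_cartesian_product)
  moreover have "S \<subseteq> very_tight_occurrences p \<pi> n \<sigma> \<longleftrightarrow> (\<forall>(x, y)\<in>R. \<sigma> x = y)" for \<sigma>
    using bound by (fastforce simp: very_tight_occurrences_def R_def E_def)
  ultimately show ?thesis
    using card_permutes_extending[of "{1..n}" R] by simp
qed

lemma finite_occurrences: "finite (very_tight_occurrences p \<pi> n \<sigma>)"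
  by (rule finite_subset[of _ "{..n} \<times> {..n}"]) (auto simp: very_tight_occurrences_def)

text \<open>
  This is the only place where the overlap hypotheses enter the count: without them a set of
  occurrences need not consist of disjoint blocks.
\<close>
lemma sets_of_occurrences_are_placements:
  assumes \<pi>: "\<pi> permutes {1..p}"
    and nso: "\<not> self_overlapping p \<pi>" "\<not> self_overlapping p (reverse_perm p \<pi>)"
    and p: "1 \<le> p" and \<sigma>: "\<sigma> permutes {1..n}"
    and S: "S \<subseteq> very_tight_occurrences p \<pi> n \<sigma>"
  shows "S \<in> placements p n (card S)"
proof -
  have occ: "\<sigma> (i + j) = \<pi> j + h" if "(i, h) \<in> S" "j \<in> {1..p}" for i h j
    using S that by (auto simp: very_tight_occurrences_def)
  have bound: "i + p \<le> n" "h + p \<le> n" if "(i, h) \<in> S" for i h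
    using S that by (auto simp: very_tight_occurrences_def)
  note inj = permutes_inj[OF \<sigma>]
  have gap: "i + p \<le> i'" if "(i, h) \<in> S" "(i', h') \<in> S" "i < i'" for i h i' h'
    using position_overlap[OF \<pi> nso inj] occ that by metis
  have gap': "h + p \<le> h'" if "(i, h) \<in> S" "(i', h') \<in> S" "h < h'" for i h i' h'
    using value_overlap[OF \<pi> nso inj] occ that by metis
  have uniq: "h = h'" if "(i, h) \<in> S" "(i, h') \<in> S" for i h h'
    using occ[OF that(1), of 1] occ[OF that(2), of 1] p by simp
  have uniq': "i = i'" if "(i, h) \<in> S" "(i', h) \<in> S" for i h i'
  proof -
    have "\<sigma> (i + 1) = \<sigma> (i' + 1)"
      using occ[OF that(1), of 1] occ[OF that(2), of 1] p by simp
    from injD[OF inj this] show ?thesis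
      by simp
  qed
  have inj1: "inj_on fst S"
    using uniq by (auto simp: inj_on_def)
  have inj2: "inj_on snd S"
    using uniq' by (auto simp: inj_on_def)
  have "fst ` S \<in> spaced_sets p n (card S)"
    unfolding spaced_sets_def using bound gap by (auto simp: card_image[OF inj1])
  moreover have "snd ` S \<in> spaced_sets p n (card S)"
    unfolding spaced_sets_def using bound gap' by (auto simp: card_image[OF inj2])
  ultimately show ?thesis
    using inj1 inj2 by (simp add: placements_def)
qed

text \<open>
  Double counting of the pairs of a permutation and a \<open>k\<close>-set of its occurrences.
\<close>
lemma sum_choose_occurrences:
  assumes \<pi>: "\<pi> permutes {1..p}"
    and nso: "\<not> self_overlapping p \<pi>" "\<not> self_overlapping p (reverse_perm p \<pi>)"
    and p: "1 \<le> p"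
  shows "(\<Sum>\<sigma> | \<sigma> permutes {1..n}. card (very_tight_occurrences p \<pi> n \<sigma>) choose k) =
           fact k * ((n - (p - 1) * k) choose k)\<^sup>2 * fact (n - p * k)"
proof -
  have "(\<Sum>\<sigma> | \<sigma> permutes {1..n}. card (very_tight_occurrences p \<pi> n \<sigma>) choose k) =
          (\<Sum>\<sigma> | \<sigma> permutes {1..n}.
             \<Sum>S | S \<in> placements p n k \<and> S \<subseteq> very_tight_occurrences p \<pi> n \<sigma>. 1)"
  proof (rule sum.cong[OF refl])
    fix \<sigma> assume "\<sigma> \<in> {\<sigma>. \<sigma> permutes {1..n}}"
    then have \<sigma>: "\<sigma> permutes {1..n}"
      by simp
    have "{S. S \<in> placements p n k \<and> S \<subseteq> very_tight_occurrences p \<pi> n \<sigma>} =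
            {S. S \<subseteq> very_tight_occurrences p \<pi> n \<sigma> \<and> card S = k}"
      using sets_of_occurrences_are_placements[OF \<pi> nso p \<sigma>] card_placement by blast
    then show "card (very_tight_occurrences p \<pi> n \<sigma>) choose k =
        (\<Sum>S | S \<in> placements p n k \<and> S \<subseteq> very_tight_occurrences p \<pi> n \<sigma>. 1)"
      using n_subsets[OF finite_occurrences] by simp
  qed
  also have "\<dots> = (\<Sum>S\<in>placements p n k.
      \<Sum>\<sigma> | \<sigma> \<in> {\<sigma>. \<sigma> permutes {1..n}} \<and> S \<subseteq> very_tight_occurrences p \<pi> n \<sigma>. 1)"
    by (rule sum.swap_restrict) (simp_all add: finite_placements finite_permutations)
  also have "\<dots> = (\<Sum>S\<in>placements p n k. fact (n - p * k))"
    using card_permutes_containing_placement[OF \<pi>] by (intro sum.cong) auto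
  also have "\<dots> = fact k * ((n - (p - 1) * k) choose k)\<^sup>2 * fact (n - p * k)"
    by (simp add: card_placements[OF p])
  finally show ?thesis .
qed

section \<open>Bonferroni's inequalities\<close>
lemma sum_alternating_choose_Suc:
  "(\<Sum>j\<le>s. (- 1) ^ j * real (Suc y choose j)) = (- 1) ^ s * real (y choose s)"
proof (induction s)
  case (Suc s)
  then show ?case
    by (simp add: algebra_simps)
qed simp

text \<open>
  For \<open>y > 0\<close> the partial sum telescopes, through Pascal's rule, to a single binomial coefficient
  \<open>(y-1) choose (s-1)\<close> up to sign.
\<close>
lemma bonferroni_none:
  "\<bar>of_bool (y = 0) - (\<Sum>j<s. (- 1) ^ j * real (y choose j))\<bar> \<le> real (y choose s)"
proof (cases s)
  case (Suc t)
  show ?thesis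
  proof (cases y)
    case 0
    have "(\<Sum>j\<le>t. (- 1) ^ j * real (0 choose j)) = 1"
      by (induction t) simp_all
    then show ?thesis
      by (simp add: Suc 0 lessThan_Suc_atMost)
  next
    case (Suc z)
    show ?thesis
      unfolding \<open>s = Suc t\<close> Suc lessThan_Suc_atMost sum_alternating_choose_Suc
      by (simp add: abs_mult power_abs)
  qed
qed simp

text \<open>
  The identity \<open>(k choose m) (x choose k) = (x choose m) ((x-m) choose (k-m))\<close> pulls the factor
  \<open>x choose m\<close> out of the sum and reduces the claim to the case \<open>m = 0\<close> for \<open>x - m\<close>.
\<close>
lemma bonferroni:
  assumes "m \<le> r"
  shows "\<bar>of_bool (x = m) - (\<Sum>k=m..<r. (- 1) ^ (k - m) * real (k choose m) * real (x choose k))\<bar>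
           \<le> real (r choose m) * real (x choose r)"
proof (cases "m \<le> x")
  case False
  then have "(x choose k) = 0" if "m \<le> k" for k
    using that by (simp add: binomial_eq_0)
  then have "(\<Sum>k=m..<r. (- 1) ^ (k - m) * real (k choose m) * real (x choose k)) = 0"
    by (intro sum.neutral) simp
  then show ?thesis
    using False by simp
next
  case True
  have mult: "real (k choose m) * real (x choose k) = real (x choose m) * real ((x - m) choose (k - m))"
    if "m \<le> k" for k
  proof (cases "k \<le> x")
    case True
    have "real ((x choose k) * (k choose m)) = real ((x choose m) * ((x - m) choose (k - m)))"
      using choose_mult[OF that True] by simp
    then show ?thesis
      by (simp add: mult.commute)
  next
    case False
    then show ?thesis
      using that \<open>m \<le> x\<close> by (simp add: binomial_eq_0)
  qed
  define F where "F = (\<Sum>j<r - m. (- 1) ^ j * real ((x - m) choose j))"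
  have "(\<Sum>k=m..<r. (- 1) ^ (k - m) * real (k choose m) * real (x choose k)) =
          (\<Sum>k=m..<r. (- 1) ^ (k - m) * (real (x choose m) * real ((x - m) choose (k - m))))"
    by (intro sum.cong refl) (simp add: mult mult.assoc)
  also have "\<dots> = real (x choose m) * F"
    unfolding F_def sum_distrib_left sum.atLeastLessThan_shift_0[of _ m r]
    by (intro sum.cong) (auto simp: mult_ac)
  finally have sum: "(\<Sum>k=m..<r. (- 1) ^ (k - m) * real (k choose m) * real (x choose k)) =
      real (x choose m) * F" .
  have "of_bool (x = m) = real (x choose m) * of_bool (x - m = 0)"
    using True by (cases "x = m") auto
  then have "\<bar>of_bool (x = m) - real (x choose m) * F\<bar> =
      real (x choose m) * \<bar>of_bool (x - m = 0) - F\<bar>"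
    by (simp only: right_diff_distrib[symmetric] abs_mult abs_of_nat)
  also have "\<dots> \<le> real (x choose m) * real ((x - m) choose (r - m))"
    unfolding F_def by (intro mult_left_mono bonferroni_none) simp
  also have "\<dots> = real (r choose m) * real (x choose r)"
    using mult[OF assms] by simp
  finally show ?thesis
    unfolding sum .
qed

definition binomial_moment :: "nat \<Rightarrow> (nat \<Rightarrow> nat) \<Rightarrow> nat \<Rightarrow> nat \<Rightarrow> real" where
  "binomial_moment p \<pi> k n =
     (\<Sum>\<sigma> | \<sigma> permutes {1..n}. real (card (very_tight_occurrences p \<pi> n \<sigma>) choose k)) / fact n"

lemma bonferroni_very_tight:
  assumes "m \<le> r"
  shows "\<bar>prob_very_tight p \<pi> m n - (\<Sum>k=m..<r. (- 1) ^ (k - m) * real (k choose m) * binomial_moment p \<pi> k n)\<bar>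
           \<le> real (r choose m) * binomial_moment p \<pi> r n"
proof -
  define U where "U = {\<sigma>. \<sigma> permutes {1..n}}"
  define X where "X \<sigma> = card (very_tight_occurrences p \<pi> n \<sigma>)" for \<sigma>
  have U: "finite U" "card U = fact n" "U \<noteq> {}"
    by (auto simp: U_def finite_permutations card_permutations intro: exI[of _ id] permutes_id)
  have moment: "binomial_moment p \<pi> k n = (\<Sum>\<sigma>\<in>U. real (X \<sigma> choose k)) / fact n" for k
    by (simp add: binomial_moment_def U_def X_def)
  have "prob_very_tight p \<pi> m n = real (card (U \<inter> {\<sigma>. X \<sigma> = m})) / fact n"
    unfolding prob_very_tight_def using measure_pmf_of_set[OF U(3,1)] U(2)
    by (simp add: U_def X_def)
  also have "real (card (U \<inter> {\<sigma>. X \<sigma> = m})) = (\<Sum>\<sigma>\<in>U. of_bool (X \<sigma> = m))"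
    using U(1) by (simp add: of_bool_def sum.If_cases)
  finally have prob: "prob_very_tight p \<pi> m n = (\<Sum>\<sigma>\<in>U. of_bool (X \<sigma> = m)) / fact n" .
  have "(\<Sum>k=m..<r. (- 1) ^ (k - m) * real (k choose m) * binomial_moment p \<pi> k n) =
          (\<Sum>k=m..<r. \<Sum>\<sigma>\<in>U. (- 1) ^ (k - m) * real (k choose m) * real (X \<sigma> choose k)) / fact n"
    by (simp add: moment sum_distrib_left sum_divide_distrib)
  also have "(\<Sum>k=m..<r. \<Sum>\<sigma>\<in>U. (- 1) ^ (k - m) * real (k choose m) * real (X \<sigma> choose k)) =
      (\<Sum>\<sigma>\<in>U. \<Sum>k=m..<r. (- 1) ^ (k - m) * real (k choose m) * real (X \<sigma> choose k))"
    by (rule sum.swap)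
  finally have "prob_very_tight p \<pi> m n -
        (\<Sum>k=m..<r. (- 1) ^ (k - m) * real (k choose m) * binomial_moment p \<pi> k n) =
      (\<Sum>\<sigma>\<in>U. of_bool (X \<sigma> = m) -
        (\<Sum>k=m..<r. (- 1) ^ (k - m) * real (k choose m) * real (X \<sigma> choose k))) / fact n"
    by (simp add: prob sum_subtractf diff_divide_distrib)
  also have "\<bar>\<dots>\<bar> \<le> (\<Sum>\<sigma>\<in>U. real (r choose m) * real (X \<sigma> choose r)) / fact n"
    unfolding abs_divide abs_of_pos[OF fact_gt_zero]
    by (intro divide_right_mono order.trans[OF sum_abs] sum_mono bonferroni[OF assms]) simp_all
  also have "\<dots> = real (r choose m) * binomial_moment p \<pi> r n"
    by (simp add: moment sum_distrib_left)
  finally show ?thesis .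
qed

section \<open>The factorial moments\<close>
lemma falling_factorial_fact:
  assumes "k \<le> n"
  shows "falling_factorial (real n) k = fact n / fact (n - k)"
  using assms
proof (induction k)
  case 0
  then show ?case
    by (simp add: falling_factorial_def)
next
  case (Suc k)
  then have "n - k = Suc (n - Suc k)"
    by linarith
  then have "fact (n - k) = (real n - real k) * fact (n - Suc k)"
    using Suc.prems by (simp add: of_nat_diff)
  moreover have "real n - real k \<noteq> 0"
    using Suc.prems by simp
  moreover have "falling_factorial (real n) (Suc k) = fact n / fact (n - k) * (real n - real k)"
    using Suc by (simp add: falling_factorial_def)
  ultimately show ?case
    by simp
qed

text \<open>
  For \<open>pk \<le> n\<close> this is the \<open>k\<close>-th factorial moment of the number of occurrences, as
  \<open>binomial_moment_eq\<close> shows; for smaller \<open>n\<close> it is merely the formula.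
\<close>
definition factorial_moment :: "nat \<Rightarrow> nat \<Rightarrow> nat \<Rightarrow> real" where
  "factorial_moment p k n =
     falling_factorial (real n - (real p - 1) * real k) k / falling_factorial (real n) ((p - 1) * k)"

lemma binomial_moment_eq:
  assumes "\<pi> permutes {1..p}" "\<not> self_overlapping p \<pi>"
    and "\<not> self_overlapping p (reverse_perm p \<pi>)" "1 \<le> p" "p * k \<le> n"
  shows "binomial_moment p \<pi> k n = factorial_moment p k n / fact k"
proof -
  \<comment> \<open>the number of points left after contracting \<open>k\<close> disjoint blocks\<close>
  define N where "N = n - (p - 1) * k"
  have pk: "p * k = (p - 1) * k + k"
    using assms(4) by (cases p) simp_all
  then have N: "k \<le> N" "(p - 1) * k \<le> n" "N - k = n - p * k"
    using assms(5) by (simp_all add: N_def)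
  have "real n - (real p - 1) * real k = real N"
    using assms(4) N(2) by (simp add: N_def of_nat_diff)
  then have main: "factorial_moment p k n = (fact N / fact (N - k)) / (fact n / fact N)"
    using falling_factorial_fact[OF N(1)] falling_factorial_fact[OF N(2)]
    by (simp only: factorial_moment_def N_def[symmetric])
  have "real (\<Sum>\<sigma> | \<sigma> permutes {1..n}. card (very_tight_occurrences p \<pi> n \<sigma>) choose k) =
      fact k * (real (N choose k))\<^sup>2 * fact (N - k)"
    unfolding sum_choose_occurrences[OF assms(1-4)] N_def[symmetric] N(3)[symmetric] by simp
  then have "binomial_moment p \<pi> k n = fact k * (real (N choose k))\<^sup>2 * fact (N - k) / fact n"
    by (simp add: binomial_moment_def)
  also have "real (N choose k) = fact N / (fact k * fact (N - k))"
    by (rule binomial_fact) (rule N(1))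
  finally show ?thesis
    by (simp add: main power2_eq_square)
qed

section \<open>Asymptotics\<close>
lemma near_one_mult:
  fixes f g :: "nat \<Rightarrow> real"
  assumes "(\<lambda>n. f n - 1) \<in> O(\<lambda>n. 1 / real n)" "(\<lambda>n. g n - 1) \<in> O(\<lambda>n. 1 / real n)"
  shows "(\<lambda>n. f n * g n - 1) \<in> O(\<lambda>n. 1 / real n)"
proof -
  have "(\<lambda>n. 1 / real n) \<in> O(\<lambda>_. 1)"
    by real_asymp
  then have "(\<lambda>n. g n - 1) \<in> O(\<lambda>_. 1)"
    by (rule landau_o.big_trans[OF assms(2)])
  from landau_o.big.mult[OF assms(1) this]
  have "(\<lambda>n. (f n - 1) * (g n - 1)) \<in> O(\<lambda>n. 1 / real n)"
    by simp
  then have "(\<lambda>n. (f n - 1) * (g n - 1) + ((f n - 1) + (g n - 1))) \<in> O(\<lambda>n. 1 / real n)"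
    by (intro sum_in_bigo assms)
  then show ?thesis
    by (simp add: algebra_simps)
qed

lemma near_one_inverse:
  fixes g :: "nat \<Rightarrow> real"
  assumes "(\<lambda>n. g n - 1) \<in> O(\<lambda>n. 1 / real n)"
  shows "(\<lambda>n. inverse (g n) - 1) \<in> O(\<lambda>n. 1 / real n)"
proof -
  have "(\<lambda>n. 1 / real n) \<in> o(\<lambda>_. 1)"
    by real_asymp
  from landau_o.big_small_trans[OF assms this] have "(\<lambda>n. g n - 1) \<longlonglongrightarrow> 0"
    by (auto dest: smalloD_tendsto)
  then have g: "g \<longlonglongrightarrow> 1"
    by (simp add: LIM_zero_iff)
  then have "(\<lambda>n. inverse (g n)) \<longlonglongrightarrow> 1"
    using tendsto_inverse[OF g] by simp
  then have "(\<lambda>n. inverse (g n)) \<in> O(\<lambda>_. 1)"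
    by (intro bigoI_tendsto[of _ _ 1]) simp_all
  from landau_o.big.mult[OF this assms]
  have "(\<lambda>n. inverse (g n) * (g n - 1)) \<in> O(\<lambda>n. 1 / real n)"
    by simp
  moreover have "eventually (\<lambda>n. inverse (g n) * (g n - 1) = - (inverse (g n) - 1)) at_top"
    using tendsto_imp_eventually_ne[OF g, of 0] by (auto elim!: eventually_mono simp: field_simps)
  ultimately have "(\<lambda>n. - (inverse (g n) - 1)) \<in> O(\<lambda>n. 1 / real n)"
    by (simp cong: landau_o.big.in_cong)
  then show ?thesis
    by (simp only: landau_o.big.uminus_in_iff)
qed

text \<open>
  Each of the \<open>k\<close> factors, divided by \<open>n\<close>, is \<open>1 + O(1/n)\<close>.
\<close>
lemma falling_factorial_near_power:
  "(\<lambda>n. falling_factorial (real n - c) k / real n ^ k - 1) \<in> O(\<lambda>n. 1 / real n)"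
proof (induction k)
  case 0
  then show ?case
    by (simp add: falling_factorial_def)
next
  case (Suc k)
  have "(\<lambda>n. (real n - c - real k) / real n - 1) \<in> O(\<lambda>n. 1 / real n)"
    by real_asymp
  from near_one_mult[OF Suc this] show ?case
    by (simp add: falling_factorial_def mult.commute)
qed

lemma factorial_moment_asymp:
  assumes "2 \<le> p"
  shows "(\<lambda>n. factorial_moment p k n - 1 / real n ^ ((p - 2) * k)) \<in> O(\<lambda>n. 1 / real n ^ ((p - 2) * k + 1))"
proof -
  define a where "a n = falling_factorial (real n - (real p - 1) * real k) k / real n ^ k" for n
  define b where "b n = falling_factorial (real n - 0) ((p - 1) * k) / real n ^ ((p - 1) * k)" for n
  have exps: "(p - 1) * k = (p - 2) * k + k"
    using assms by (metis Suc_diff_le add.commute diff_Suc_Suc mult_Suc numeral_2_eq_2 One_nat_def)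
  have "(\<lambda>n. a n * inverse (b n) - 1) \<in> O(\<lambda>n. 1 / real n)"
    unfolding a_def b_def by (intro near_one_mult near_one_inverse falling_factorial_near_power)
  from landau_o.big.mult[OF this landau_o.big_refl[of "\<lambda>n. 1 / real n ^ ((p - 2) * k)"]]
  have "(\<lambda>n. (a n * inverse (b n) - 1) * (1 / real n ^ ((p - 2) * k)))
          \<in> O(\<lambda>n. 1 / real n ^ ((p - 2) * k + 1))"
    by (simp add: mult.commute)
  moreover have "eventually (\<lambda>n. (a n * inverse (b n) - 1) * (1 / real n ^ ((p - 2) * k)) =
      factorial_moment p k n - 1 / real n ^ ((p - 2) * k)) at_top"
    using eventually_gt_at_top[of 0]
  proof eventually_elim
    case (elim n)
    have pow: "real n ^ ((p - 1) * k) = real n ^ ((p - 2) * k) * real n ^ k"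
      by (simp only: exps power_add)
    have "a n * inverse (b n) = factorial_moment p k n * real n ^ ((p - 2) * k)"
      unfolding a_def b_def factorial_moment_def pow using elim by simp
    then show ?case
      using elim by (simp add: field_simps)
  qed
  ultimately show ?thesis
    by (simp cong: landau_o.big.in_cong)
qed

lemma power_bigo_mono:
  "a \<le> b \<Longrightarrow> (\<lambda>n. 1 / real n ^ b) \<in> O(\<lambda>n. 1 / real n ^ a)"
proof (rule landau_o.bigI[of 1])
  assume "a \<le> b"
  show "eventually (\<lambda>n. norm (1 / real n ^ b) \<le> 1 * norm (1 / real n ^ a)) at_top"
    using eventually_ge_at_top[of 1]
  proof eventually_elim
    case (elim n)
    then show ?case
      using power_increasing[OF \<open>a \<le> b\<close>, of "real n"] by (simp add: frac_le)
  qed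
qed simp

lemma factorial_moment_bigo:
  assumes "2 \<le> p"
  shows "factorial_moment p k \<in> O(\<lambda>n. 1 / real n ^ ((p - 2) * k))"
proof -
  have "(\<lambda>n. (factorial_moment p k n - 1 / real n ^ ((p - 2) * k)) + 1 / real n ^ ((p - 2) * k))
          \<in> O(\<lambda>n. 1 / real n ^ ((p - 2) * k))"
    by (intro sum_in_bigo landau_o.big_trans[OF factorial_moment_asymp[OF assms] power_bigo_mono]) simp_all
  then show ?thesis
    by simp
qed

text \<open>
  Bonferroni's inequality is truncated at \<open>s = max m r\<close>.  For \<open>r < m\<close> the sum is empty and the
  truncation at \<open>m\<close> says that the probability of \<open>m\<close> occurrences is at most the \<open>m\<close>-th binomial
  moment, which is within the required bound.
\<close>
lemma prob_very_tight_expansion: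
  assumes \<pi>: "\<pi> permutes {1..p}"
    and nso: "\<not> self_overlapping p \<pi>" "\<not> self_overlapping p (reverse_perm p \<pi>)"
    and p: "2 \<le> p"
  shows "(\<lambda>n. prob_very_tight p \<pi> m n -
            1 / fact m * (\<Sum>k\<in>{m..<r}. (- 1) ^ (k - m) / fact (k - m) * factorial_moment p k n))
         \<in> O(\<lambda>n. 1 / real n ^ ((p - 2) * r))"
proof -
  define s where "s = max m r"
  have s: "m \<le> s" "r \<le> s" "{m..<s} = {m..<r}"
    by (auto simp: s_def)
  have coeff: "real (k choose m) / fact k = 1 / fact m * (1 / fact (k - m))" if "m \<le> k" for k
    using binomial_fact[OF that, where 'a = real] by simp
  have "eventually (\<lambda>n. norm (prob_very_tight p \<pi> m n -
            1 / fact m * (\<Sum>k\<in>{m..<r}. (- 1) ^ (k - m) / fact (k - m) * factorial_moment p k n))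
          \<le> real (s choose m) / fact s * norm (factorial_moment p s n)) at_top"
    using eventually_ge_at_top[of "p * s"]
  proof eventually_elim
    case (elim n)
    have moment: "binomial_moment p \<pi> k n = factorial_moment p k n / fact k" if "k \<le> s" for k
    proof (rule binomial_moment_eq[OF \<pi> nso])
      show "p * k \<le> n"
        using that elim by (meson le_trans mult_le_mono2)
    qed (use p in simp)
    have "1 / fact m * (\<Sum>k\<in>{m..<r}. (- 1) ^ (k - m) / fact (k - m) * factorial_moment p k n) =
        (\<Sum>k=m..<s. (- 1) ^ (k - m) * real (k choose m) * binomial_moment p \<pi> k n)"
      unfolding s(3) sum_distrib_left
    proof (rule sum.cong[OF refl])
      fix k assume k: "k \<in> {m..<r}"
      have "(- 1) ^ (k - m) * real (k choose m) * binomial_moment p \<pi> k n =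
          (- 1) ^ (k - m) * (real (k choose m) / fact k) * factorial_moment p k n"
        using k s(2) by (simp add: moment)
      also have "\<dots> = (- 1) ^ (k - m) * (1 / fact m * (1 / fact (k - m))) * factorial_moment p k n"
        using k by (simp only: coeff atLeastLessThan_iff)
      finally show "1 / fact m * ((- 1) ^ (k - m) / fact (k - m) * factorial_moment p k n) =
          (- 1) ^ (k - m) * real (k choose m) * binomial_moment p \<pi> k n"
        by simp
    qed
    then have "norm (prob_very_tight p \<pi> m n -
            1 / fact m * (\<Sum>k\<in>{m..<r}. (- 1) ^ (k - m) / fact (k - m) * factorial_moment p k n))
        \<le> real (s choose m) * binomial_moment p \<pi> s n"
      using bonferroni_very_tight[OF s(1), of p \<pi> n] by simp
    also have "\<dots> = real (s choose m) / fact s * factorial_moment p s n"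
      by (simp add: moment)
    also have "\<dots> \<le> real (s choose m) / fact s * norm (factorial_moment p s n)"
      by (intro mult_left_mono) simp_all
    finally show ?case .
  qed
  then have "(\<lambda>n. prob_very_tight p \<pi> m n -
            1 / fact m * (\<Sum>k\<in>{m..<r}. (- 1) ^ (k - m) / fact (k - m) * factorial_moment p k n))
         \<in> O(factorial_moment p s)"
    by (rule bigoI)
  also have "factorial_moment p s \<in> O(\<lambda>n. 1 / real n ^ ((p - 2) * s))"
    by (rule factorial_moment_bigo[OF p])
  also have "(\<lambda>n. 1 / real n ^ ((p - 2) * s)) \<in> O(\<lambda>n. 1 / real n ^ ((p - 2) * r))"
    by (rule power_bigo_mono) (simp add: s(2))
  finally show ?thesis .
qed

text \<open>
  The second estimate is the expansion with \<open>r = m + 1\<close>, whose sum consists of the single term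
  \<open>k = m\<close>.  Its error has exponent \<open>(p-2)(m+1)\<close>, at least \<open>(p-2)m + 1\<close> because \<open>p \<ge> 3\<close>, and
  replacing the factorial moment by \<open>n\<^bsup>-(p-2)m\<^esup>\<close> costs a relative error \<open>O(1/n)\<close>.
\<close>
theorem theorem4p1:
  fixes p m :: nat and \<pi> :: "nat \<Rightarrow> nat"
  assumes "p \<ge> 3"
    and "\<pi> permutes {1..p}"
    and "\<not> self_overlapping p \<pi>"
    and "\<not> self_overlapping p (reverse_perm p \<pi>)"
  shows "(\<forall>r::nat. r > 0 \<longrightarrow>
            (\<lambda>n. prob_very_tight p \<pi> m n -
                 1 / fact m *
                 (\<Sum>k\<in>{m..<r}. (-1) ^ (k - m) / fact (k - m) *
                    (falling_factorial (real n - (real p - 1) * real k) k /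
                     falling_factorial (real n) ((p - 1) * k))))
            \<in> O(\<lambda>n. 1 / real n ^ ((p - 2) * r)))
       \<and> (\<lambda>n. prob_very_tight p \<pi> m n - 1 / fact m * (1 / real n ^ ((p - 2) * m)))
           \<in> O(\<lambda>n. 1 / real n ^ ((p - 2) * m + 1))"
proof -
  have p: "2 \<le> p"
    using assms(1) by simp
  note expansion = prob_very_tight_expansion[OF assms(2-4) p, of m]
  have "(\<lambda>n. prob_very_tight p \<pi> m n - 1 / fact m * factorial_moment p m n)
          \<in> O(\<lambda>n. 1 / real n ^ ((p - 2) * (m + 1)))"
    using expansion[of "m + 1"] by simp
  also have "(\<lambda>n. 1 / real n ^ ((p - 2) * (m + 1))) \<in> O(\<lambda>n. 1 / real n ^ ((p - 2) * m + 1))"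
    by (rule power_bigo_mono) (use assms(1) in simp)
  finally have first: "(\<lambda>n. prob_very_tight p \<pi> m n - 1 / fact m * factorial_moment p m n)
      \<in> O(\<lambda>n. 1 / real n ^ ((p - 2) * m + 1))" .
  have "(\<lambda>n. 1 / fact m * (factorial_moment p m n - 1 / real n ^ ((p - 2) * m)))
      \<in> O(\<lambda>n. 1 / real n ^ ((p - 2) * m + 1))"
    using factorial_moment_asymp[OF p, of m] by (subst landau_o.big.cmult_in_iff) simp_all
  from sum_in_bigo(1)[OF first this] have "(\<lambda>n. (prob_very_tight p \<pi> m n - 1 / fact m * factorial_moment p m n) +
        1 / fact m * (factorial_moment p m n - 1 / real n ^ ((p - 2) * m)))
      \<in> O(\<lambda>n. 1 / real n ^ ((p - 2) * m + 1))"
    .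
  then have "(\<lambda>n. prob_very_tight p \<pi> m n - 1 / fact m * (1 / real n ^ ((p - 2) * m)))
      \<in> O(\<lambda>n. 1 / real n ^ ((p - 2) * m + 1))"
    by (simp only: right_diff_distrib add_diff_eq diff_add_cancel)
  with expansion show ?thesis
    unfolding factorial_moment_def by blast
qed

end
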